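(* Let $\mathcal{T}_0$ be a theory with signature $\Pi_0=(\Sigma_0,\mathsf{Pred})$, let $\Sigma_1$ be a set of new function symbols, $\Pi=(\Sigma_0\cup\Sigma_1,\mathsf{Pred})$, and let $\mathcal{K}$ be a family of $\Sigma_1$-flat clauses in the signature $\Pi$; put $\mathcal{T}_1:=\mathcal{T}_0\cup\mathcal{K}$. (1) If the extension $\mathcal{T}_0\subseteq\mathcal{T}_1$ satisfies $(\mathsf{Loc})$, then it satisfies $(\mathsf{Emb_w})$. (2) If the extension $\mathcal{T}_0\subseteq\mathcal{T}_1$ satisfies $(\mathsf{Loc^f})$, then it satisfies $(\mathsf{Emb^f_w})$. (3) If the extension $\mathcal{T}_0\subseteq\mathcal{T}_1$ satisfies $(\mathsf{Loc^{fd}})$, then it satisfies $(\mathsf{Emb^{fd}_w})$. (4) If $\mathcal{T}_0$ is compact and the extension $\mathcal{T}_0\subseteq\mathcal{T}_1$ satisfies $(\mathsf{Loc^f})$, then $\mathcal{T}_0\subseteq\mathcal{T}_1$ satisfies $(\mathsf{Emb_w})$.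
   Context: A partial $\Pi$-structure $A$ (for $\Pi=(\Sigma,\mathsf{Pred})$) is a nonempty set with, for each $n$-ary $f\in\Sigma$, a partial function $f_A:A^n\rightharpoonup A$, and for each $n$-ary $P\in\mathsf{Pred}$ a relation $P_A\subseteq A^n$; it is total if all $f_A$ are total. Under an assignment $\beta:X\to A$ a term $f(t_1,\dots,t_n)$ is undefined if some $\beta(t_i)$ is undefined or $f_A$ is undefined at $(\beta(t_1),\dots,\beta(t_n))$. Weak satisfaction: $(A,\beta)\models_w s\approx t$ iff $\beta(s),\beta(t)$ are both defined and equal or at least one is undefined; $(A,\beta)\models_w s\not\approx t$ iff both are defined and different or at least one is undefined; $(A,\beta)\models_w P(t_1,\dots,t_n)$ iff all $\beta(t_i)$ are defined and the tuple is in $P_A$, or some $\beta(t_i)$ is undefined; $(A,\beta)\models_w\neg P(t_1,\dots,t_n)$ iff all are defined and the tuple is not in $P_A$, or some is undefined. A clause is weakly satisfied by $(A,\beta)$ if one of its literals is; $A\models_w C$ if this holds for all $\beta$; $A\models_w\mathcal{K}$ if $A\models_w C$ for all $C\in\mathcal{K}$. A weak $\Pi$-embedding $i:A\to B$ of partial $\Pi$-structures is an injective total map such that whenever $f_A(a_1,\dots,a_n)$ is defined, $f_B(i(a_1),\dots,i(a_n))$ is defined and equals $i(f_A(a_1,\dots,a_n))$, and $P_A(a_1,\dots,a_n)$ iff $P_B(i(a_1),\dots,i(a_n))$ for all $P\in\mathsf{Pred}$. A weak partial model of $\mathcal{T}_1=\mathcal{T}_0\cup\mathcal{K}$ is a partial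 $\Pi$-structure whose $\Pi_0$-reduct is a (total) model of $\mathcal{T}_0$ and which weakly satisfies $\mathcal{K}$ (the $\Sigma_1$-functions may be partial). $(\mathsf{Emb_w})$: every weak partial model of $\mathcal{T}_1$ weakly embeds into a total model of $\mathcal{T}_1$. $(\mathsf{Emb^f_w})$: the same for every finite weak partial model. $(\mathsf{Emb^{fd}_w})$: the same for every weak partial model in which each $\Sigma_1$-function has a finite domain of definition. Ground clauses $G$ are over $\Pi$ extended by new constants. $\mathsf{st}(\mathcal{K},G)$ is the set of ground subterms occurring in $\mathcal{K}$ or $G$, and $\mathcal{K}[G]$ is the set of instances of clauses of $\mathcal{K}$ in which every term starting with a $\Sigma_1$-symbol is a ground term in $\mathsf{st}(\mathcal{K},G)$. $(\mathsf{Loc})$: for every set $G$ of ground clauses, $\mathcal{T}_1\cup G\models\bot$ iff $\mathcal{T}_0\cup\mathcal{K}[G]\cup G$ has no weak partial model in which all terms of $\mathsf{st}(\mathcal{K},G)$ are defined. $(\mathsf{Loc^f})$: the same condition for all finite $G$. $(\mathsf{Loc^{fd}})$: the same for all $G$ containing only finitely many terms starting with a $\Sigma_1$-symbol. A non-ground clause is $\Sigma_1$-flat if no function symbol (including constants) occurs as an argument of a function symbol in $\Sigma_1$. $\mathcal{T}_0$ is compact if whenever $\mathcal{T}_0$ together with a set of formulae is unsatisfiable, it is already unsatisfiable together with a finite subset of that set.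
   Formalization: Added, since the claim fails otherwise: no Σ1-constant occurs in K (all parts); the signature is finite in (2); Σ1 is finite in (3). A theory is given as a class of total structures within one arbitrary universe, which also supplies the new constants. *)

theory Defs
  imports Main
begin

record ('f, 'p) signature =
  funs :: "'f set"
  preds :: "'p set"
  farity :: "'f \<Rightarrow> nat"
  parity :: "'p \<Rightarrow> nat"

datatype 'f trm = Var nat | Fun 'f "'f trm list"

datatype ('f, 'p) atom = Eq "'f trm" "'f trm" | Pr 'p "'f trm list"

datatype ('f, 'p) lit = Pos "('f, 'p) atom" | Neg "('f, 'p) atom"

type_synonym ('f, 'p) clause = "('f, 'p) lit list"

datatype ('f, 'p) fm =
    Bot_fm
  | Atom_fm "('f, 'p) atom"
  | Neg_fm "('f, 'p) fm"
  | Or_fm "('f, 'p) fm" "('f, 'p) fm"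
  | All_fm nat "('f, 'p) fm"


subsection \<open>Syntax\<close>

fun subtrms :: "'f trm \<Rightarrow> 'f trm set" where
  "subtrms (Var x) = {Var x}"
| "subtrms (Fun f ts) = insert (Fun f ts) (\<Union>t\<in>set ts. subtrms t)"

fun ground :: "'f trm \<Rightarrow> bool" where
  "ground (Var x) = False"
| "ground (Fun f ts) = (\<forall>t\<in>set ts. ground t)"

fun subst :: "(nat \<Rightarrow> 'f trm) \<Rightarrow> 'f trm \<Rightarrow> 'f trm" where
  "subst \<sigma> (Var x) = \<sigma> x"
| "subst \<sigma> (Fun f ts) = Fun f (map (subst \<sigma>) ts)"

fun subst_atom :: "(nat \<Rightarrow> 'f trm) \<Rightarrow> ('f, 'p) atom \<Rightarrow> ('f, 'p) atom" where
  "subst_atom \<sigma> (Eq s t) = Eq (subst \<sigma> s) (subst \<sigma> t)"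
| "subst_atom \<sigma> (Pr p ts) = Pr p (map (subst \<sigma>) ts)"

fun subst_lit :: "(nat \<Rightarrow> 'f trm) \<Rightarrow> ('f, 'p) lit \<Rightarrow> ('f, 'p) lit" where
  "subst_lit \<sigma> (Pos a) = Pos (subst_atom \<sigma> a)"
| "subst_lit \<sigma> (Neg a) = Neg (subst_atom \<sigma> a)"

fun atom_of :: "('f, 'p) lit \<Rightarrow> ('f, 'p) atom" where
  "atom_of (Pos a) = a"
| "atom_of (Neg a) = a"

fun atom_trms :: "('f, 'p) atom \<Rightarrow> 'f trm set" where
  "atom_trms (Eq s t) = subtrms s \<union> subtrms t"
| "atom_trms (Pr p ts) = (\<Union>t\<in>set ts. subtrms t)"

definition clause_trms :: "('f, 'p) clause \<Rightarrow> 'f trm set" where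
  "clause_trms C = (\<Union>L\<in>set C. atom_trms (atom_of L))"

fun wf_trm :: "('f, 'p) signature \<Rightarrow> 'f trm \<Rightarrow> bool" where
  "wf_trm \<Pi> (Var x) = True"
| "wf_trm \<Pi> (Fun f ts) =
    (f \<in> funs \<Pi> \<and> length ts = farity \<Pi> f \<and> (\<forall>t\<in>set ts. wf_trm \<Pi> t))"

fun wf_atom :: "('f, 'p) signature \<Rightarrow> ('f, 'p) atom \<Rightarrow> bool" where
  "wf_atom \<Pi> (Eq s t) = (wf_trm \<Pi> s \<and> wf_trm \<Pi> t)"
| "wf_atom \<Pi> (Pr p ts) =
    (p \<in> preds \<Pi> \<and> length ts = parity \<Pi> p \<and> (\<forall>t\<in>set ts. wf_trm \<Pi> t))"

definition wf_clause :: "('f, 'p) signature \<Rightarrow> ('f, 'p) clause \<Rightarrow> bool" where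
  "wf_clause \<Pi> C \<longleftrightarrow> (\<forall>L\<in>set C. wf_atom \<Pi> (atom_of L))"

definition ground_clause :: "('f, 'p) clause \<Rightarrow> bool" where
  "ground_clause C \<longleftrightarrow> (\<forall>t\<in>clause_trms C. ground t)"

fun wf_fm :: "('f, 'p) signature \<Rightarrow> ('f, 'p) fm \<Rightarrow> bool" where
  "wf_fm \<Pi> Bot_fm = True"
| "wf_fm \<Pi> (Atom_fm a) = wf_atom \<Pi> a"
| "wf_fm \<Pi> (Neg_fm \<phi>) = wf_fm \<Pi> \<phi>"
| "wf_fm \<Pi> (Or_fm \<phi> \<psi>) = (wf_fm \<Pi> \<phi> \<and> wf_fm \<Pi> \<psi>)"
| "wf_fm \<Pi> (All_fm x \<phi>) = wf_fm \<Pi> \<phi>"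

definition starts_with :: "'f set \<Rightarrow> 'f trm \<Rightarrow> bool" where
  "starts_with S t \<longleftrightarrow> (\<exists>f ts. t = Fun f ts \<and> f \<in> S)"

definition flat_clause :: "'f set \<Rightarrow> ('f, 'p) clause \<Rightarrow> bool" where
  "flat_clause \<Sigma>1 C \<longleftrightarrow>
    (\<forall>f ts. f \<in> \<Sigma>1 \<longrightarrow> Fun f ts \<in> clause_trms C \<longrightarrow> (\<forall>t\<in>set ts. \<exists>x. t = Var x))"


subsection \<open>Partial structures and weak satisfaction\<close>

record ('f, 'p, 'u) struct =
  carrier :: "'u set"
  func :: "'f \<Rightarrow> 'u list \<Rightarrow> 'u option"
  rel :: "'p \<Rightarrow> 'u list set"

definition tuples :: "'u set \<Rightarrow> nat \<Rightarrow> 'u list set" where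
  "tuples A n = {as. length as = n \<and> set as \<subseteq> A}"

text \<open>Symbols outside the signature are interpreted trivially, so that a structure is determined
  by its carrier and the interpretation of the symbols of its signature.\<close>

definition partial_structure :: "('f, 'p) signature \<Rightarrow> ('f, 'p, 'u) struct \<Rightarrow> bool" where
  "partial_structure \<Pi> A \<longleftrightarrow>
    carrier A \<noteq> {} \<and>
    (\<forall>f\<in>funs \<Pi>. dom (func A f) \<subseteq> tuples (carrier A) (farity \<Pi> f) \<and> ran (func A f) \<subseteq> carrier A) \<and>
    (\<forall>p\<in>preds \<Pi>. rel A p \<subseteq> tuples (carrier A) (parity \<Pi> p)) \<and>
    (\<forall>f. f \<notin> funs \<Pi> \<longrightarrow> func A f = Map.empty) \<and>
    (\<forall>p. p \<notin> preds \<Pi> \<longrightarrow> rel A p = {})"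

definition total_structure :: "('f, 'p) signature \<Rightarrow> ('f, 'p, 'u) struct \<Rightarrow> bool" where
  "total_structure \<Pi> A \<longleftrightarrow>
    partial_structure \<Pi> A \<and>
    (\<forall>f\<in>funs \<Pi>. dom (func A f) = tuples (carrier A) (farity \<Pi> f))"

definition reduct :: "('f, 'p) signature \<Rightarrow> ('f, 'p, 'u) struct \<Rightarrow> ('f, 'p, 'u) struct" where
  "reduct \<Pi> A = \<lparr> carrier = carrier A,
     func = (\<lambda>f. if f \<in> funs \<Pi> then func A f else Map.empty),
     rel = (\<lambda>p. if p \<in> preds \<Pi> then rel A p else {}) \<rparr>"

definition assignment :: "('f, 'p, 'u) struct \<Rightarrow> (nat \<Rightarrow> 'u) \<Rightarrow> bool" where
  "assignment A \<beta> \<longleftrightarrow> (\<forall>x. \<beta> x \<in> carrier A)"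

fun eval :: "('f, 'p, 'u) struct \<Rightarrow> (nat \<Rightarrow> 'u) \<Rightarrow> 'f trm \<Rightarrow> 'u option" where
  "eval A \<beta> (Var x) = Some (\<beta> x)"
| "eval A \<beta> (Fun f ts) =
    (if \<exists>t\<in>set ts. eval A \<beta> t = None then None
     else func A f (map (\<lambda>t. the (eval A \<beta> t)) ts))"

fun wsat_lit :: "('f, 'p, 'u) struct \<Rightarrow> (nat \<Rightarrow> 'u) \<Rightarrow> ('f, 'p) lit \<Rightarrow> bool" where
  "wsat_lit A \<beta> (Pos (Eq s t)) \<longleftrightarrow>
    eval A \<beta> s = None \<or> eval A \<beta> t = None \<or> the (eval A \<beta> s) = the (eval A \<beta> t)"
| "wsat_lit A \<beta> (Neg (Eq s t)) \<longleftrightarrow>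
    eval A \<beta> s = None \<or> eval A \<beta> t = None \<or> the (eval A \<beta> s) \<noteq> the (eval A \<beta> t)"
| "wsat_lit A \<beta> (Pos (Pr p ts)) \<longleftrightarrow>
    (\<exists>t\<in>set ts. eval A \<beta> t = None) \<or> map (\<lambda>t. the (eval A \<beta> t)) ts \<in> rel A p"
| "wsat_lit A \<beta> (Neg (Pr p ts)) \<longleftrightarrow>
    (\<exists>t\<in>set ts. eval A \<beta> t = None) \<or> map (\<lambda>t. the (eval A \<beta> t)) ts \<notin> rel A p"

definition wsat :: "('f, 'p, 'u) struct \<Rightarrow> ('f, 'p) clause \<Rightarrow> bool" where
  "wsat A C \<longleftrightarrow> (\<forall>\<beta>. assignment A \<beta> \<longrightarrow> (\<exists>L\<in>set C. wsat_lit A \<beta> L))"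

text \<open>Used for total structures only, where weak satisfaction of literals is classical
  satisfaction.\<close>

fun fm_sat :: "('f, 'p, 'u) struct \<Rightarrow> (nat \<Rightarrow> 'u) \<Rightarrow> ('f, 'p) fm \<Rightarrow> bool" where
  "fm_sat A \<beta> Bot_fm \<longleftrightarrow> False"
| "fm_sat A \<beta> (Atom_fm a) \<longleftrightarrow> wsat_lit A \<beta> (Pos a)"
| "fm_sat A \<beta> (Neg_fm \<phi>) \<longleftrightarrow> \<not> fm_sat A \<beta> \<phi>"
| "fm_sat A \<beta> (Or_fm \<phi> \<psi>) \<longleftrightarrow> fm_sat A \<beta> \<phi> \<or> fm_sat A \<beta> \<psi>"
| "fm_sat A \<beta> (All_fm x \<phi>) \<longleftrightarrow> (\<forall>a\<in>carrier A. fm_sat A (\<beta>(x := a)) \<phi>)"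

definition fm_valid :: "('f, 'p, 'u) struct \<Rightarrow> ('f, 'p) fm \<Rightarrow> bool" where
  "fm_valid A \<phi> \<longleftrightarrow> (\<forall>\<beta>. assignment A \<beta> \<longrightarrow> fm_sat A \<beta> \<phi>)"

definition weak_embedding ::
  "('f, 'p) signature \<Rightarrow> ('u \<Rightarrow> 'v) \<Rightarrow> ('f, 'p, 'u) struct \<Rightarrow> ('f, 'p, 'v) struct \<Rightarrow> bool" where
  "weak_embedding \<Pi> i A B \<longleftrightarrow>
    i ` carrier A \<subseteq> carrier B \<and> inj_on i (carrier A) \<and>
    (\<forall>f\<in>funs \<Pi>. \<forall>as a. func A f as = Some a \<longrightarrow> func B f (map i as) = Some (i a)) \<and>
    (\<forall>p\<in>preds \<Pi>. \<forall>as\<in>tuples (carrier A) (parity \<Pi> p). as \<in> rel A p \<longleftrightarrow> map i as \<in> rel B p)"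


subsection \<open>Theory extensions and embeddability\<close>

text \<open>A theory is given by its class of models, all structures being taken inside one arbitrary
  universe \<open>'u\<close>; a set of axioms is covered through its class of models.\<close>

definition is_theory :: "('f, 'p) signature \<Rightarrow> ('f, 'p, 'u) struct set \<Rightarrow> bool" where
  "is_theory \<Pi>0 T0 \<longleftrightarrow> (\<forall>M\<in>T0. total_structure \<Pi>0 M)"

definition extend_sig :: "('f, 'p) signature \<Rightarrow> 'f set \<Rightarrow> ('f, 'p) signature" where
  "extend_sig \<Pi>0 \<Sigma>1 = \<Pi>0\<lparr>funs := funs \<Pi>0 \<union> \<Sigma>1\<rparr>"

definition weak_partial_model ::
  "('f, 'p) signature \<Rightarrow> 'f set \<Rightarrow> ('f, 'p, 'u) struct set \<Rightarrow> ('f, 'p) clause set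
    \<Rightarrow> ('f, 'p, 'u) struct \<Rightarrow> bool" where
  "weak_partial_model \<Pi>0 \<Sigma>1 T0 K A \<longleftrightarrow>
    partial_structure (extend_sig \<Pi>0 \<Sigma>1) A \<and> reduct \<Pi>0 A \<in> T0 \<and> (\<forall>C\<in>K. wsat A C)"

definition total_model ::
  "('f, 'p) signature \<Rightarrow> 'f set \<Rightarrow> ('f, 'p, 'u) struct set \<Rightarrow> ('f, 'p) clause set
    \<Rightarrow> ('f, 'p, 'u) struct \<Rightarrow> bool" where
  "total_model \<Pi>0 \<Sigma>1 T0 K A \<longleftrightarrow>
    total_structure (extend_sig \<Pi>0 \<Sigma>1) A \<and> reduct \<Pi>0 A \<in> T0 \<and> (\<forall>C\<in>K. wsat A C)"

definition embeds_in_total_model ::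
  "('f, 'p) signature \<Rightarrow> 'f set \<Rightarrow> ('f, 'p, 'u) struct set \<Rightarrow> ('f, 'p) clause set
    \<Rightarrow> ('f, 'p, 'u) struct \<Rightarrow> bool" where
  "embeds_in_total_model \<Pi>0 \<Sigma>1 T0 K A \<longleftrightarrow>
    (\<exists>B i. total_model \<Pi>0 \<Sigma>1 T0 K B \<and> weak_embedding (extend_sig \<Pi>0 \<Sigma>1) i A B)"

definition Emb_w ::
  "('f, 'p) signature \<Rightarrow> 'f set \<Rightarrow> ('f, 'p, 'u) struct set \<Rightarrow> ('f, 'p) clause set \<Rightarrow> bool" where
  "Emb_w \<Pi>0 \<Sigma>1 T0 K \<longleftrightarrow>
    (\<forall>A. weak_partial_model \<Pi>0 \<Sigma>1 T0 K A \<longrightarrow> embeds_in_total_model \<Pi>0 \<Sigma>1 T0 K A)"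

definition Emb_w_f ::
  "('f, 'p) signature \<Rightarrow> 'f set \<Rightarrow> ('f, 'p, 'u) struct set \<Rightarrow> ('f, 'p) clause set \<Rightarrow> bool" where
  "Emb_w_f \<Pi>0 \<Sigma>1 T0 K \<longleftrightarrow>
    (\<forall>A. weak_partial_model \<Pi>0 \<Sigma>1 T0 K A \<and> finite (carrier A)
      \<longrightarrow> embeds_in_total_model \<Pi>0 \<Sigma>1 T0 K A)"

definition Emb_w_fd ::
  "('f, 'p) signature \<Rightarrow> 'f set \<Rightarrow> ('f, 'p, 'u) struct set \<Rightarrow> ('f, 'p) clause set \<Rightarrow> bool" where
  "Emb_w_fd \<Pi>0 \<Sigma>1 T0 K \<longleftrightarrow>
    (\<forall>A. weak_partial_model \<Pi>0 \<Sigma>1 T0 K A \<and> (\<forall>f\<in>\<Sigma>1. finite (dom (func A f)))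
      \<longrightarrow> embeds_in_total_model \<Pi>0 \<Sigma>1 T0 K A)"


subsection \<open>New constants and locality\<close>

text \<open>The new constants are the symbols \<open>Inr c\<close>. In the locality conditions below \<open>c\<close> ranges over
  the universe \<open>'u\<close> of the structures. No generality is lost: for a set of ground clauses over a
  larger supply of constants, constants with the same value in a given structure can be renamed
  to that value.\<close>

definition with_constants :: "('f, 'p) signature \<Rightarrow> ('f + 'c, 'p) signature" where
  "with_constants \<Pi> = \<lparr> funs = Inl ` funs \<Pi> \<union> range Inr, preds = preds \<Pi>,
     farity = case_sum (farity \<Pi>) (\<lambda>_. 0), parity = parity \<Pi> \<rparr>"

definition forget_constants :: "('f + 'c, 'p, 'u) struct \<Rightarrow> ('f, 'p, 'u) struct" where
  "forget_constants A = \<lparr> carrier = carrier A, func = (\<lambda>f. func A (Inl f)), rel = rel A \<rparr>"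

definition lift_clause :: "('f, 'p) clause \<Rightarrow> ('f + 'c, 'p) clause" where
  "lift_clause C = map (map_lit Inl id) C"

definition ground_clauses ::
  "('f, 'p) signature \<Rightarrow> 'f set \<Rightarrow> ('f + 'c, 'p) clause set \<Rightarrow> bool" where
  "ground_clauses \<Pi>0 \<Sigma>1 G \<longleftrightarrow>
    (\<forall>C\<in>G. wf_clause (with_constants (extend_sig \<Pi>0 \<Sigma>1)) C \<and> ground_clause C)"

text \<open>Only the symbols of \<open>\<Sigma>1\<close> may be partial; the new constants are always defined.\<close>

definition weak_partial_model_c ::
  "('f, 'p) signature \<Rightarrow> 'f set \<Rightarrow> ('f, 'p, 'u) struct set \<Rightarrow> ('f + 'c, 'p) clause set
    \<Rightarrow> ('f + 'c, 'p, 'u) struct \<Rightarrow> bool" where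
  "weak_partial_model_c \<Pi>0 \<Sigma>1 T0 N A \<longleftrightarrow>
    partial_structure (with_constants (extend_sig \<Pi>0 \<Sigma>1)) A \<and>
    (\<forall>c. func A (Inr c) [] \<noteq> None) \<and>
    reduct \<Pi>0 (forget_constants A) \<in> T0 \<and> (\<forall>C\<in>N. wsat A C)"

definition total_model_c ::
  "('f, 'p) signature \<Rightarrow> 'f set \<Rightarrow> ('f, 'p, 'u) struct set \<Rightarrow> ('f + 'c, 'p) clause set
    \<Rightarrow> ('f + 'c, 'p, 'u) struct \<Rightarrow> bool" where
  "total_model_c \<Pi>0 \<Sigma>1 T0 N A \<longleftrightarrow>
    total_structure (with_constants (extend_sig \<Pi>0 \<Sigma>1)) A \<and>
    reduct \<Pi>0 (forget_constants A) \<in> T0 \<and> (\<forall>C\<in>N. wsat A C)"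

definition st :: "('f, 'p) clause set \<Rightarrow> ('f + 'c, 'p) clause set \<Rightarrow> ('f + 'c) trm set" where
  "st K G = {t \<in> (\<Union>C \<in> lift_clause ` K \<union> G. clause_trms C). ground t}"

definition instances ::
  "('f, 'p) signature \<Rightarrow> 'f set \<Rightarrow> ('f, 'p) clause set \<Rightarrow> ('f + 'c, 'p) clause set
    \<Rightarrow> ('f + 'c, 'p) clause set" where
  "instances \<Pi>0 \<Sigma>1 K G =
    {map (subst_lit \<sigma>) (lift_clause C) | C \<sigma>.
       C \<in> K \<and> (\<forall>x. wf_trm (with_constants (extend_sig \<Pi>0 \<Sigma>1)) (\<sigma> x)) \<and>
       (\<forall>t \<in> clause_trms (map (subst_lit \<sigma>) (lift_clause C)).
          starts_with (Inl ` \<Sigma>1) t \<longrightarrow> t \<in> st K G)}"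

definition defined_in :: "('f, 'p, 'u) struct \<Rightarrow> 'f trm \<Rightarrow> bool" where
  "defined_in A t \<longleftrightarrow> (\<forall>\<beta>. assignment A \<beta> \<longrightarrow> eval A \<beta> t \<noteq> None)"

definition local_for ::
  "('f, 'p) signature \<Rightarrow> 'f set \<Rightarrow> ('f, 'p, 'u) struct set \<Rightarrow> ('f, 'p) clause set
    \<Rightarrow> ('f + 'u, 'p) clause set \<Rightarrow> bool" where
  "local_for \<Pi>0 \<Sigma>1 T0 K G \<longleftrightarrow>
    ((\<nexists>A. total_model_c \<Pi>0 \<Sigma>1 T0 (lift_clause ` K \<union> G) A) \<longleftrightarrow>
     (\<nexists>A. weak_partial_model_c \<Pi>0 \<Sigma>1 T0 (instances \<Pi>0 \<Sigma>1 K G \<union> G) A \<and>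
          (\<forall>t\<in>st K G. defined_in A t)))"

definition Loc ::
  "('f, 'p) signature \<Rightarrow> 'f set \<Rightarrow> ('f, 'p, 'u) struct set \<Rightarrow> ('f, 'p) clause set \<Rightarrow> bool" where
  "Loc \<Pi>0 \<Sigma>1 T0 K \<longleftrightarrow> (\<forall>G. ground_clauses \<Pi>0 \<Sigma>1 G \<longrightarrow> local_for \<Pi>0 \<Sigma>1 T0 K G)"

definition Loc_f ::
  "('f, 'p) signature \<Rightarrow> 'f set \<Rightarrow> ('f, 'p, 'u) struct set \<Rightarrow> ('f, 'p) clause set \<Rightarrow> bool" where
  "Loc_f \<Pi>0 \<Sigma>1 T0 K \<longleftrightarrow>
    (\<forall>G. ground_clauses \<Pi>0 \<Sigma>1 G \<and> finite G \<longrightarrow> local_for \<Pi>0 \<Sigma>1 T0 K G)"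

definition Loc_fd ::
  "('f, 'p) signature \<Rightarrow> 'f set \<Rightarrow> ('f, 'p, 'u) struct set \<Rightarrow> ('f, 'p) clause set \<Rightarrow> bool" where
  "Loc_fd \<Pi>0 \<Sigma>1 T0 K \<longleftrightarrow>
    (\<forall>G. ground_clauses \<Pi>0 \<Sigma>1 G \<and>
         finite {t \<in> (\<Union>C\<in>G. clause_trms C). starts_with (Inl ` \<Sigma>1) t}
      \<longrightarrow> local_for \<Pi>0 \<Sigma>1 T0 K G)"

text \<open>The formulae range over the signature of the extension with new constants. Free variables
  are read as universally quantified, as in clauses.\<close>

definition satisfiable_with ::
  "('f, 'p) signature \<Rightarrow> 'f set \<Rightarrow> ('f, 'p, 'u) struct set \<Rightarrow> ('f + 'u, 'p) fm set \<Rightarrow> bool" where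
  "satisfiable_with \<Pi>0 \<Sigma>1 T0 F \<longleftrightarrow>
    (\<exists>A. total_model_c \<Pi>0 \<Sigma>1 T0 {} A \<and> (\<forall>\<phi>\<in>F. fm_valid A \<phi>))"

definition compact_theory ::
  "('f, 'p) signature \<Rightarrow> 'f set \<Rightarrow> ('f, 'p, 'u) struct set \<Rightarrow> bool" where
  "compact_theory \<Pi>0 \<Sigma>1 T0 \<longleftrightarrow>
    (\<forall>F. (\<forall>\<phi>\<in>F. wf_fm (with_constants (extend_sig \<Pi>0 \<Sigma>1)) \<phi>) \<and> \<not> satisfiable_with \<Pi>0 \<Sigma>1 T0 F
      \<longrightarrow> (\<exists>F'\<subseteq>F. finite F' \<and> \<not> satisfiable_with \<Pi>0 \<Sigma>1 T0 F'))"

end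

theory Submission
  imports Defs
begin

text \<open>
  Name the elements of a weak partial model \<open>A\<close> by the new constants and let \<open>G\<close> be the diagram of
  \<open>A\<close>: the inequalities between distinct elements, the defined function values, and the positive and
  negative predicate facts. A total model of \<open>\<T>\<^sub>1 \<union> G\<close> is the same thing as a total model of
  \<open>\<T>\<^sub>1\<close> with a weak embedding of \<open>A\<close>. By flatness every ground term of the axioms is a base term,
  hence defined in \<open>A\<close>, and a substitution producing an instance in \<open>\<K>[G]\<close> only takes values defined
  in \<open>A\<close>; so \<open>A\<close> is a weak partial model of \<open>\<K>[G] \<union> G\<close>, and locality yields the total model.
  If only finite sets \<open>G\<close> are allowed, the argument applies to the finite subsets of the diagram,
  and compactness combines them.
\<close>

section \<open>Terms\<close>

lemma subtrms_refl: "t \<in> subtrms t"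
  by (cases t) auto

lemma subtrms_trans: "s \<in> subtrms t \<Longrightarrow> subtrms s \<subseteq> subtrms t"
  by (induction t) auto

lemma subtrms_subst: "s \<in> subtrms t \<Longrightarrow> subtrms (subst \<sigma> s) \<subseteq> subtrms (subst \<sigma> t)"
  by (induction t) auto

lemma subtrms_map_trm: "subtrms (map_trm h t) = map_trm h ` subtrms t"
  by (induction t) auto

lemma ground_map_trm: "ground (map_trm h t) \<longleftrightarrow> ground t"
  by (induction t) auto

lemma ground_subtrms: "ground t \<Longrightarrow> s \<in> subtrms t \<Longrightarrow> ground s"
  by (induction t) auto

lemma wf_subtrms: "wf_trm \<Pi> t \<Longrightarrow> s \<in> subtrms t \<Longrightarrow> wf_trm \<Pi> s"
  by (induction t) auto

section \<open>Terms and clauses under lifting and substitution\<close>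

lemma wf_trm_lift: "wf_trm \<Pi> t \<Longrightarrow> wf_trm (with_constants \<Pi>) (map_trm Inl t)"
  by (induction t) (auto simp: with_constants_def)

lemma wf_atom_lift: "wf_atom \<Pi> a \<Longrightarrow> wf_atom (with_constants \<Pi>) (map_atom Inl id a)"
  by (cases a) (auto simp: wf_trm_lift, auto simp: with_constants_def)

lemma atom_of_map_lit: "atom_of (map_lit h k L) = map_atom h k (atom_of L)"
  by (cases L) auto

lemma atom_of_subst_lit: "atom_of (subst_lit \<sigma> L) = subst_atom \<sigma> (atom_of L)"
  by (cases L) auto

lemma wf_clause_lift: "wf_clause \<Pi> C \<Longrightarrow> wf_clause (with_constants \<Pi>) (lift_clause C)"
  by (auto simp: wf_clause_def lift_clause_def atom_of_map_lit wf_atom_lift)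

lemma atom_trms_map_atom: "atom_trms (map_atom h k a) = map_trm h ` atom_trms a"
  by (cases a) (auto simp: subtrms_map_trm)

lemma clause_trms_lift: "clause_trms (lift_clause C) = map_trm Inl ` clause_trms C"
  by (auto simp: clause_trms_def lift_clause_def atom_of_map_lit atom_trms_map_atom)

lemma atom_trms_subtrms: "t \<in> atom_trms a \<Longrightarrow> subtrms t \<subseteq> atom_trms a"
  by (cases a) (use subtrms_trans in fastforce)+

lemma clause_trms_subtrms: "t \<in> clause_trms C \<Longrightarrow> s \<in> subtrms t \<Longrightarrow> s \<in> clause_trms C"
  unfolding clause_trms_def using atom_trms_subtrms by fastforce

lemma atom_trms_subst: "t \<in> atom_trms a \<Longrightarrow> subtrms (subst \<sigma> t) \<subseteq> atom_trms (subst_atom \<sigma> a)"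
  by (cases a) (use subtrms_subst in fastforce)+

text \<open>For \<open>t\<close> a variable \<open>x\<close> of \<open>C\<close>, all subterms of
  \<open>\<sigma> x\<close> occur in the instance. The condition on \<Sigma>1-terms in
  \<open>instances\<close> thereby constrains the substitution itself.\<close>

lemma clause_trms_subst:
  "t \<in> clause_trms C \<Longrightarrow> subtrms (subst \<sigma> t) \<subseteq> clause_trms (map (subst_lit \<sigma>) C)"
  unfolding clause_trms_def using atom_trms_subst by (fastforce simp: atom_of_subst_lit)

lemma wf_atom_trms: "wf_atom \<Pi> a \<Longrightarrow> t \<in> atom_trms a \<Longrightarrow> wf_trm \<Pi> t"
  by (cases a) (use wf_subtrms in fastforce)+

lemma wf_clause_trms: "wf_clause \<Pi> C \<Longrightarrow> t \<in> clause_trms C \<Longrightarrow> wf_trm \<Pi> t"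
  unfolding wf_clause_def clause_trms_def using wf_atom_trms by fastforce

section \<open>Evaluation and weak satisfaction\<close>

text \<open>The value of a compound term lies in the range of some \<open>func A f\<close>; symbols
  outside the signature are nowhere defined, so \<open>f\<close> is in the signature and its range
  lies in the carrier.\<close>

lemma eval_in_carrier:
  assumes "partial_structure \<Pi> A" "assignment A \<beta>" "eval A \<beta> t = Some a"
  shows "a \<in> carrier A"
proof (cases t)
  case (Var x)
  then show ?thesis using assms by (auto simp: assignment_def)
next
  case (Fun f ts)
  then obtain as where "func A f as = Some a"
    using assms(3) by (auto split: if_splits)
  then have "a \<in> ran (func A f)" "f \<in> funs \<Pi>"
    using assms(1) by (auto simp: ran_def partial_structure_def)
  then show ?thesis using assms(1) by (auto simp: partial_structure_def)
qed

text \<open>Induction on \<open>t\<close>, with two ways to pass a function symbol: the subterm is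
  already known to be defined, as for the terms of \<open>st\<close>, or the symbol is total, as for
  base symbols and new constants.\<close>

lemma eval_defined:
  assumes "partial_structure \<Pi> A" "assignment A \<beta>" "wf_trm \<Pi> t"
    and "\<And>f ts. Fun f ts \<in> subtrms t \<Longrightarrow> f \<in> funs \<Pi> \<Longrightarrow>
      eval A \<beta> (Fun f ts) \<noteq> None \<or> dom (func A f) = tuples (carrier A) (farity \<Pi> f)"
  shows "eval A \<beta> t \<noteq> None"
  using assms(3,4)
proof (induction t)
  case (Var x)
  then show ?case by simp
next
  case (Fun f ts)
  have args: "eval A \<beta> t \<noteq> None" if "t \<in> set ts" for t
  proof (rule Fun.IH[OF that])
    show "wf_trm \<Pi> t" using Fun.prems(1) that by auto
  next
    fix g us assume "Fun g us \<in> subtrms t" "g \<in> funs \<Pi>"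
    then show "eval A \<beta> (Fun g us) \<noteq> None \<or> dom (func A g) = tuples (carrier A) (farity \<Pi> g)"
      using Fun.prems(2)[of g us] that by fastforce
  qed
  have "map (\<lambda>t. the (eval A \<beta> t)) ts \<in> tuples (carrier A) (farity \<Pi> f)"
    using args eval_in_carrier[OF assms(1,2)] Fun.prems(1)
    by (fastforce simp: tuples_def)
  moreover have "eval A \<beta> (Fun f ts) \<noteq> None \<or> dom (func A f) = tuples (carrier A) (farity \<Pi> f)"
    using Fun.prems by auto
  ultimately show ?case using args by auto
qed

lemma eval_total:
  assumes "total_structure \<Pi> A" "assignment A \<beta>" "wf_trm \<Pi> t"
  shows "eval A \<beta> t \<noteq> None"
  using assms by (intro eval_defined[of \<Pi>]) (auto simp: total_structure_def)

text \<open>The substitution lemma for partial evaluation. An assignment gives every variable a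
  value, so each \<open>\<sigma> x\<close> with \<open>x\<close> occurring in \<open>t\<close> has
  to be defined.\<close>

lemma eval_subst:
  assumes "\<And>x. Var x \<in> subtrms t \<Longrightarrow> eval A \<beta> (\<sigma> x) = Some (\<beta>' x)"
  shows "eval A \<beta> (subst \<sigma> t) = eval A \<beta>' t"
  using assms
proof (induction t)
  case (Var x)
  then show ?case by simp
next
  case (Fun f ts)
  have "eval A \<beta> (subst \<sigma> t) = eval A \<beta>' t" if "t \<in> set ts" for t
    using Fun that by auto
  then show ?case by (auto simp: comp_def cong: map_cong)
qed

lemma wsat_lit_subst:
  assumes "\<And>x. Var x \<in> atom_trms (atom_of L) \<Longrightarrow> eval A \<beta> (\<sigma> x) = Some (\<beta>' x)"
  shows "wsat_lit A \<beta> (subst_lit \<sigma> L) \<longleftrightarrow> wsat_lit A \<beta>' L"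
proof -
  have eq: "eval A \<beta> (subst \<sigma> t) = eval A \<beta>' t" if "t \<in> atom_trms (atom_of L)" for t
    using assms that atom_trms_subtrms[OF that] by (intro eval_subst) auto
  obtain a where "L = Pos a \<or> L = Neg a" by (cases L) auto
  then show ?thesis
  proof (cases a)
    case (Eq s t)
    then show ?thesis
      using \<open>L = Pos a \<or> L = Neg a\<close> eq[of s] eq[of t] by (auto simp: subtrms_refl)
  next
    case (Pr p ts)
    have "\<forall>t\<in>set ts. eval A \<beta> (subst \<sigma> t) = eval A \<beta>' t"
      using \<open>L = Pos a \<or> L = Neg a\<close> Pr eq subtrms_refl by fastforce
    then have "map (\<lambda>t. the (eval A \<beta> (subst \<sigma> t))) ts = map (\<lambda>t. the (eval A \<beta>' t)) ts"
      "(\<exists>t\<in>set ts. eval A \<beta> (subst \<sigma> t) = None) \<longleftrightarrow> (\<exists>t\<in>set ts. eval A \<beta>' t = None)"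
      by simp_all
    then show ?thesis
      using \<open>L = Pos a \<or> L = Neg a\<close> Pr
      by (elim disjE) (simp_all add: comp_def del: map_eq_conv not_None_eq)
  qed
qed

section \<open>Lifted clauses and the reduct that forgets the constants\<close>

lemma eval_lift: "eval A \<beta> (map_trm Inl t) = eval (forget_constants A) \<beta> t"
proof (induction t)
  case (Var x)
  then show ?case by simp
next
  case (Fun f ts)
  have "func (forget_constants A) f = func A (Inl f)" by (simp add: forget_constants_def)
  with Fun show ?case by (auto simp: comp_def cong: map_cong)
qed

lemma wsat_lit_lift: "wsat_lit A \<beta> (map_lit Inl id L) \<longleftrightarrow> wsat_lit (forget_constants A) \<beta> L"
proof -
  have [simp]: "rel (forget_constants A) = rel A" by (simp add: forget_constants_def)
  obtain a where "L = Pos a \<or> L = Neg a" by (cases L) auto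
  then show ?thesis by (cases a) (auto simp: eval_lift comp_def)
qed

text \<open>A lifted clause contains only function symbols \<open>Inl f\<close>, so the
  interpretation of the constants does not affect it.\<close>

lemma wsat_lift: "wsat A (lift_clause C) \<longleftrightarrow> wsat (forget_constants A) C"
  unfolding wsat_def lift_clause_def assignment_def
  by (simp add: wsat_lit_lift) (simp add: forget_constants_def)

section \<open>Clauses as formulae\<close>

text \<open>Compactness speaks of formulae, locality of clauses; this translation connects
  them.\<close>

fun lit_fm :: "('f, 'p) lit \<Rightarrow> ('f, 'p) fm" where
  "lit_fm (Pos a) = Atom_fm a"
| "lit_fm (Neg a) = Neg_fm (Atom_fm a)"

text \<open>No quantifiers are added: \<open>fm_valid\<close> reads free variables universally, just
  as \<open>wsat\<close> does.\<close>

fun clause_fm :: "('f, 'p) clause \<Rightarrow> ('f, 'p) fm" where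
  "clause_fm [] = Bot_fm"
| "clause_fm (L # C) = Or_fm (lit_fm L) (clause_fm C)"

lemma wf_lit_fm: "wf_fm \<Pi> (lit_fm L) \<longleftrightarrow> wf_atom \<Pi> (atom_of L)"
  by (cases L) auto

lemma wf_clause_fm: "wf_fm \<Pi> (clause_fm C) \<longleftrightarrow> wf_clause \<Pi> C"
  by (induction C) (auto simp: wf_clause_def wf_lit_fm)

text \<open>Classical negation and a weakly satisfied negative literal differ only when some term is
  undefined, which totality excludes.\<close>

lemma fm_sat_lit_fm:
  assumes "total_structure \<Pi> A" "assignment A \<beta>" "wf_atom \<Pi> (atom_of L)"
  shows "fm_sat A \<beta> (lit_fm L) \<longleftrightarrow> wsat_lit A \<beta> L"
proof (cases L)
  case (Pos a)
  then show ?thesis by simp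
next
  case (Neg a)
  then show ?thesis using assms(3) by (cases a) (auto simp: eval_total[OF assms(1,2)] simp del: not_None_eq)
qed

lemma fm_valid_clause_fm:
  assumes "total_structure \<Pi> A" "wf_clause \<Pi> C"
  shows "fm_valid A (clause_fm C) \<longleftrightarrow> wsat A C"
proof -
  have "fm_sat A \<beta> (clause_fm C) \<longleftrightarrow> (\<exists>L\<in>set C. wsat_lit A \<beta> L)" if "assignment A \<beta>" for \<beta>
    using assms(2) by (induction C) (auto simp: wf_clause_def fm_sat_lit_fm[OF assms(1) that])
  then show ?thesis by (auto simp: fm_valid_def wsat_def)
qed

section \<open>The diagram of a partial structure\<close>

abbreviation cst :: "'c \<Rightarrow> ('f + 'c) trm" where
  "cst c \<equiv> Fun (Inr c) []"

text \<open>Constants that name no element of the carrier must denote something as well.\<close>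

definition name_constants :: "('f, 'p, 'u) struct \<Rightarrow> ('f + 'u, 'p, 'u) struct" where
  "name_constants A = \<lparr> carrier = carrier A,
     func = case_sum (func A)
       (\<lambda>c. [[] \<mapsto> (if c \<in> carrier A then c else (SOME a. a \<in> carrier A))]),
     rel = rel A \<rparr>"

text \<open>A diagram in the sense of Robinson, fitted to weak embeddings: undefined function values
  leave no trace, since they may become defined in the target, while predicates are recorded with
  both signs, since they have to be preserved and reflected.\<close>

definition diagram :: "('f, 'p) signature \<Rightarrow> ('f, 'p, 'u) struct \<Rightarrow> ('f + 'u, 'p) clause set" where
  "diagram \<Pi> A =
    {[Neg (Eq (cst a) (cst b))] | a b. a \<in> carrier A \<and> b \<in> carrier A \<and> a \<noteq> b} \<union>
    {[Pos (Eq (Fun (Inl f) (map cst as)) (cst a))] | f as a. f \<in> funs \<Pi> \<and> func A f as = Some a} \<union>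
    {[Pos (Pr p (map cst as))] | p as. p \<in> preds \<Pi> \<and> as \<in> rel A p} \<union>
    {[Neg (Pr p (map cst as))] | p as.
       p \<in> preds \<Pi> \<and> as \<in> tuples (carrier A) (parity \<Pi> p) - rel A p}"

lemma diagram_cases:
  assumes "C \<in> diagram \<Pi> A"
  obtains a b where "C = [Neg (Eq (cst a) (cst b))]" "a \<in> carrier A" "b \<in> carrier A" "a \<noteq> b"
  | f as a where "C = [Pos (Eq (Fun (Inl f) (map cst as)) (cst a))]"
      "f \<in> funs \<Pi>" "func A f as = Some a"
  | p as where "C = [Pos (Pr p (map cst as))]" "p \<in> preds \<Pi>" "as \<in> rel A p"
  | p as where "C = [Neg (Pr p (map cst as))]" "p \<in> preds \<Pi>"
      "as \<in> tuples (carrier A) (parity \<Pi> p)" "as \<notin> rel A p"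
  using assms unfolding diagram_def by (elim UnE CollectE exE conjE DiffE) simp_all

lemma partial_structure_func:
  assumes "partial_structure \<Pi> A" "func A f as = Some a"
  shows "f \<in> funs \<Pi>" "length as = farity \<Pi> f" "set as \<subseteq> carrier A" "a \<in> carrier A"
proof -
  show f: "f \<in> funs \<Pi>" using assms by (auto simp: partial_structure_def)
  have "as \<in> dom (func A f)" "a \<in> ran (func A f)" using assms(2) by (auto simp: ran_def)
  then show "length as = farity \<Pi> f" "set as \<subseteq> carrier A" "a \<in> carrier A"
    using assms(1) f by (auto simp: partial_structure_def tuples_def)
qed

lemma partial_structure_rel:
  assumes "partial_structure \<Pi> A" "p \<in> preds \<Pi>" "as \<in> rel A p"
  shows "length as = parity \<Pi> p" "set as \<subseteq> carrier A"
proof -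
  have "rel A p \<subseteq> tuples (carrier A) (parity \<Pi> p)"
    using assms(1,2) by (simp add: partial_structure_def)
  then show "length as = parity \<Pi> p" "set as \<subseteq> carrier A"
    using assms(3) by (auto simp: tuples_def)
qed

section \<open>The expansion of a partial structure by names for its elements\<close>

lemma forget_name_constants: "forget_constants (name_constants A) = A"
  by (simp add: forget_constants_def name_constants_def)

lemma partial_structure_name_constants:
  assumes "partial_structure \<Pi> A"
  shows "partial_structure (with_constants \<Pi>) (name_constants A)"
proof -
  have "carrier A \<noteq> {}" using assms by (simp add: partial_structure_def)
  \<comment> \<open>The default value of the constants that name no element; it lies in the carrier
    because carriers are nonempty.\<close>
  then have c: "(SOME a. a \<in> carrier A) \<in> carrier A" by (simp add: some_in_eq)
  show ?thesis
    unfolding partial_structure_def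
  proof (intro conjI ballI allI impI)
    fix g assume "g \<in> funs (with_constants \<Pi> :: ('a + 'c, 'b) signature)"
    then show "dom (func (name_constants A) g) \<subseteq>
        tuples (carrier (name_constants A)) (farity (with_constants \<Pi>) g)"
      "ran (func (name_constants A) g) \<subseteq> carrier (name_constants A)"
      using assms c
      by (cases g; simp add: partial_structure_def name_constants_def with_constants_def tuples_def;
          blast)+
  next
    fix g :: "'a + 'c" assume "g \<notin> funs (with_constants \<Pi>)"
    then show "func (name_constants A) g = Map.empty"
      using assms by (cases g)
        (auto simp: partial_structure_def name_constants_def with_constants_def)
  qed (use assms in \<open>auto simp: partial_structure_def name_constants_def with_constants_def\<close>)
qed

lemma eval_name_constants_cst: "a \<in> carrier A \<Longrightarrow> eval (name_constants A) \<beta> (cst a) = Some a"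
  by (simp add: name_constants_def)

lemma map_eval_name_constants_csts:
  "set as \<subseteq> carrier A \<Longrightarrow> map (\<lambda>t. the (eval (name_constants A) \<beta> t)) (map cst as) = as"
  by (induction as) (simp_all add: name_constants_def)

lemma eval_name_constants_csts:
  "t \<in> set (map cst as) \<Longrightarrow> eval (name_constants A) \<beta> t \<noteq> None"
  by (auto simp: name_constants_def)

text \<open>Every argument is a constant, hence defined, and denotes the element it names; so the
  term is undefined exactly when \<open>func A f as\<close> is.\<close>

lemma eval_name_constants_Fun:
  assumes "set as \<subseteq> carrier A"
  shows "eval (name_constants A) \<beta> (Fun (Inl f) (map cst as)) = func A f as"
proof -
  have "eval (name_constants A) \<beta> (Fun (Inl f) (map cst as)) = func (name_constants A) (Inl f) as"
    unfolding eval.simps(2) map_eval_name_constants_csts[OF assms]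
    using eval_name_constants_csts[of _ as A \<beta>] by meson
  then show ?thesis by (simp add: name_constants_def)
qed

lemma wf_diagram:
  assumes "partial_structure \<Pi> A" "C \<in> diagram \<Pi> A"
  shows "wf_clause (with_constants \<Pi>) C" "ground_clause C"
proof -
  note defs = wf_clause_def ground_clause_def clause_trms_def with_constants_def
  from assms(2) have "wf_clause (with_constants \<Pi>) C \<and> ground_clause C"
  proof (cases rule: diagram_cases)
    case (2 f as a)
    then show ?thesis using partial_structure_func[OF assms(1) 2(3)] by (auto simp: defs)
  next
    case (3 p as)
    then show ?thesis using partial_structure_rel[OF assms(1) 3(2,3)] by (auto simp: defs)
  qed (auto simp: defs tuples_def)
  then show "wf_clause (with_constants \<Pi>) C" "ground_clause C" by auto
qed

lemma wsat_diagram: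
  assumes "partial_structure \<Pi> A" "C \<in> diagram \<Pi> A"
  shows "wsat (name_constants A) C"
proof -
  let ?N = "name_constants A"
  have "\<exists>L\<in>set C. wsat_lit ?N \<beta> L" for \<beta>
    using assms(2)
  proof (cases rule: diagram_cases)
    case (1 a b)
    then show ?thesis by (simp add: eval_name_constants_cst del: eval.simps)
  next
    case (2 f as a)
    note as = partial_structure_func[OF assms(1) 2(3)]
    show ?thesis
      using 2 as(3,4)
      by (simp add: eval_name_constants_cst eval_name_constants_Fun del: eval.simps)
  next
    case (3 p as)
    note as = partial_structure_rel(2)[OF assms(1) 3(2,3)]
    have "rel ?N p = rel A p" by (simp add: name_constants_def)
    then have "wsat_lit ?N \<beta> (Pos (Pr p (map cst as)))"
      unfolding wsat_lit.simps map_eval_name_constants_csts[OF as] using 3 by simp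
    then show ?thesis using 3(1) by (simp del: wsat_lit.simps)
  next
    case (4 p as)
    then have as: "set as \<subseteq> carrier A" by (simp add: tuples_def)
    have "rel ?N p = rel A p" by (simp add: name_constants_def)
    then have "wsat_lit ?N \<beta> (Neg (Pr p (map cst as)))"
      unfolding wsat_lit.simps map_eval_name_constants_csts[OF as] using 4 by simp
    then show ?thesis using 4(1) by (simp del: wsat_lit.simps)
  qed
  then show ?thesis by (simp add: wsat_def)
qed

text \<open>The diagram mentions a function term only where the function is defined. This gives both
  the definedness of its terms and the count of its \<Sigma>1-terms.\<close>

lemma diagram_trms:
  assumes "C \<in> diagram \<Pi> A" "t \<in> clause_trms C"
  obtains a where "t = cst a"
  | f as a where "t = Fun (Inl f) (map cst as)" "f \<in> funs \<Pi>" "func A f as = Some a"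
  using assms(1)
  by (cases rule: diagram_cases) (use assms(2) in \<open>auto simp: clause_trms_def\<close>)

lemma defined_diagram:
  assumes "partial_structure \<Pi> A" "C \<in> diagram \<Pi> A" "t \<in> clause_trms C"
  shows "defined_in (name_constants A) t"
  using assms(2,3)
proof (cases rule: diagram_trms)
  case (1 a)
  then show ?thesis by (simp add: defined_in_def name_constants_def)
next
  case (2 f as a)
  then show ?thesis
    using partial_structure_func(3)[OF assms(1) 2(3)]
    by (simp add: defined_in_def eval_name_constants_Fun del: eval.simps)
qed

section \<open>Finiteness of the diagram and of its \<Sigma>1-terms\<close>

text \<open>There are finitely many symbols, and finitely many tuples over a finite carrier for each
  arity. The finiteness of the signature in the second implication enters here.\<close>

lemma finite_diagram:
  assumes "partial_structure \<Pi> A" "finite (carrier A)" "finite (funs \<Pi>)" "finite (preds \<Pi>)"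
  shows "finite (diagram \<Pi> A)"
proof -
  let ?T = "\<lambda>n. tuples (carrier A) n"
  have fin: "finite (?T n)" for n
    using finite_lists_length_eq[OF assms(2), of n] by (simp add: tuples_def conj_commute)
  \<comment> \<open>One image of a finite index set for each kind of clause. Side conditions such as
    \<open>a \<noteq> b\<close> or membership in \<open>rel A p\<close> are dropped, which only
    enlarges the images.\<close>
  let ?D1 = "(\<lambda>(a, b). [Neg (Eq (cst a) (cst b))]) ` (carrier A \<times> carrier A)"
  let ?D2 = "(\<lambda>(f, as, a). [Pos (Eq (Fun (Inl f) (map cst as)) (cst a))]) `
    (SIGMA f:funs \<Pi>. ?T (farity \<Pi> f) \<times> carrier A)"
  let ?D3 = "(\<lambda>(p, as). [Pos (Pr p (map cst as))]) ` (SIGMA p:preds \<Pi>. ?T (parity \<Pi> p))"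
  let ?D4 = "(\<lambda>(p, as). [Neg (Pr p (map cst as))]) ` (SIGMA p:preds \<Pi>. ?T (parity \<Pi> p))"
  have "C \<in> ?D1 \<union> ?D2 \<union> ?D3 \<union> ?D4" if "C \<in> diagram \<Pi> A" for C
    using that
  proof (cases rule: diagram_cases)
    case (1 a b)
    then have "C \<in> ?D1" by (intro image_eqI[of _ _ "(a, b)"]) simp_all
    then show ?thesis by (simp only: Un_iff simp_thms)
  next
    case (2 f as a)
    then have "C \<in> ?D2"
      using partial_structure_func[OF assms(1) 2(3)]
      by (intro image_eqI[of _ _ "(f, as, a)"]) (simp_all add: tuples_def)
    then show ?thesis by (simp only: Un_iff simp_thms)
  next
    case (3 p as)
    then have "C \<in> ?D3"
      using partial_structure_rel[OF assms(1) 3(2,3)]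
      by (intro image_eqI[of _ _ "(p, as)"]) (simp_all add: tuples_def)
    then show ?thesis by (simp only: Un_iff simp_thms)
  next
    case (4 p as)
    then have "C \<in> ?D4" by (intro image_eqI[of _ _ "(p, as)"]) simp_all
    then show ?thesis by (simp only: Un_iff simp_thms)
  qed
  then have "diagram \<Pi> A \<subseteq> ?D1 \<union> ?D2 \<union> ?D3 \<union> ?D4" by (rule subsetI)
  moreover have "finite (?D1 \<union> ?D2 \<union> ?D3 \<union> ?D4)"
    using assms fin by (intro finite_UnI finite_imageI finite_SigmaI finite_cartesian_product) auto
  ultimately show ?thesis by (rule finite_subset)
qed

text \<open>A \<Sigma>1-term of the diagram is determined by a symbol of \<Sigma>1 and a tuple in
  its domain of definition; the new constants do not start with an \<open>Inl\<close>
  symbol.\<close>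

lemma finite_diagram_trms:
  assumes "finite \<Sigma>1" "\<forall>f\<in>\<Sigma>1. finite (dom (func A f))"
  shows "finite {t \<in> (\<Union>C\<in>diagram \<Pi> A. clause_trms C). starts_with (Inl ` \<Sigma>1) t}"
proof (rule finite_subset)
  show "{t \<in> (\<Union>C\<in>diagram \<Pi> A. clause_trms C). starts_with (Inl ` \<Sigma>1) t} \<subseteq>
    (\<lambda>(f, as). Fun (Inl f) (map cst as)) ` (SIGMA f:\<Sigma>1. dom (func A f))"
    by (force simp: starts_with_def elim: diagram_trms)
  show "finite ((\<lambda>(f, as). Fun (Inl f) (map cst as)) ` (SIGMA f:\<Sigma>1. dom (func A f)))"
    using assms by auto
qed

section \<open>From total models of the diagram to weak embeddings\<close>

text \<open>Satisfaction of a clause quantifies over all assignments; a nonempty carrier supplies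
  one, which is enough to read off a ground literal.\<close>

lemma wsat_singleton:
  assumes "total_structure \<Pi> B" "wsat B [L]"
  obtains \<beta> where "assignment B \<beta>" "wsat_lit B \<beta> L"
proof -
  obtain b where "b \<in> carrier B"
    using assms(1) by (auto simp: total_structure_def partial_structure_def)
  then have "assignment B (\<lambda>_. b)" by (simp add: assignment_def)
  with assms(2) that show ?thesis by (auto simp: wsat_def)
qed

lemma total_structure_forget_constants:
  fixes \<Pi> :: "('f, 'p) signature" and B :: "('f + 'c, 'p, 'u) struct"
  assumes "total_structure (with_constants \<Pi>) B"
  shows "total_structure \<Pi> (forget_constants B)"
  unfolding total_structure_def partial_structure_def
proof (intro conjI ballI allI impI)
  have ps: "partial_structure (with_constants \<Pi>) B"
    using assms by (simp add: total_structure_def)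
  show "carrier (forget_constants B) \<noteq> {}"
    using ps by (simp add: partial_structure_def forget_constants_def)
  show "rel (forget_constants B) p \<subseteq> tuples (carrier (forget_constants B)) (parity \<Pi> p)"
    if "p \<in> preds \<Pi>" for p
    using ps that by (simp add: partial_structure_def forget_constants_def with_constants_def)
  show "rel (forget_constants B) p = {}" if "p \<notin> preds \<Pi>" for p
    using ps that by (simp add: partial_structure_def forget_constants_def with_constants_def)
  show "func (forget_constants B) f = Map.empty" if "f \<notin> funs \<Pi>" for f
  proof -
    have "\<forall>g. g \<notin> funs (with_constants \<Pi>) \<longrightarrow> func B g = Map.empty"
      using ps by (simp add: partial_structure_def)
    then have "func B (Inl f) = Map.empty" using that by (auto simp: with_constants_def)
    then show ?thesis by (simp add: forget_constants_def)
  qed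
  fix f assume "f \<in> funs \<Pi>"
  then have f: "(Inl f :: 'f + 'c) \<in> funs (with_constants \<Pi>)" by (simp add: with_constants_def)
  then have "dom (func B (Inl f)) = tuples (carrier B) (farity (with_constants \<Pi>) (Inl f :: 'f + 'c))"
    using assms by (simp add: total_structure_def)
  then show dom:
    "dom (func (forget_constants B) f) = tuples (carrier (forget_constants B)) (farity \<Pi> f)"
    by (simp add: forget_constants_def with_constants_def)
  then show
    "dom (func (forget_constants B) f) \<subseteq> tuples (carrier (forget_constants B)) (farity \<Pi> f)"
    by simp
  show "ran (func (forget_constants B) f) \<subseteq> carrier (forget_constants B)"
    using ps f by (simp add: partial_structure_def forget_constants_def)
qed

text \<open>Each element goes to the value of its constant in \<open>B\<close>. The inequalities
  give injectivity, the equations preserve defined function values, and the predicate literals give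
  preservation and reflection.\<close>

lemma embedding_of_diagram_model:
  fixes A :: "('f, 'p, 'u) struct" and B :: "('f + 'u, 'p, 'u) struct"
  assumes A: "partial_structure (extend_sig \<Pi>0 \<Sigma>1) A"
    and B: "total_model_c \<Pi>0 \<Sigma>1 T0 (lift_clause ` K \<union> diagram (extend_sig \<Pi>0 \<Sigma>1) A) B"
  shows "embeds_in_total_model \<Pi>0 \<Sigma>1 T0 K A"
proof -
  let ?\<Pi> = "extend_sig \<Pi>0 \<Sigma>1"
  let ?B = "forget_constants B"
  have tot: "total_structure (with_constants ?\<Pi>) B"
    and red: "reduct \<Pi>0 ?B \<in> T0"
    and sat: "\<And>C. C \<in> lift_clause ` K \<union> diagram ?\<Pi> A \<Longrightarrow> wsat B C"
    using B by (auto simp: total_model_c_def)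
  define i where "i a = the (func B (Inr a) [])" for a :: 'u
  have "[] \<in> dom (func B (Inr a))" for a :: 'u
    using tot by (auto simp: total_structure_def with_constants_def tuples_def)
  then have cst: "func B (Inr a) [] = Some (i a)" for a :: 'u
    by (auto simp: i_def dom_def)
  have i_mem: "i a \<in> carrier B" for a
    using partial_structure_func(4)[OF _ cst] tot by (auto simp: total_structure_def)
  have "total_model \<Pi>0 \<Sigma>1 T0 K ?B"
    using total_structure_forget_constants[OF tot] red sat
    by (auto simp: total_model_def simp flip: wsat_lift)
  moreover have "weak_embedding ?\<Pi> i A ?B"
    unfolding weak_embedding_def
  proof (intro conjI ballI allI impI inj_onI)
    show "i ` carrier A \<subseteq> carrier ?B"
      using i_mem by (auto simp: forget_constants_def)
  next
    fix a b assume ab: "a \<in> carrier A" "b \<in> carrier A" "i a = i b"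
    show "a = b"
    proof (rule ccontr)
      assume "a \<noteq> b"
      then have "[Neg (Eq (cst a) (cst b))] \<in> diagram ?\<Pi> A" using ab by (auto simp: diagram_def)
      then have "wsat B [Neg (Eq (cst a) (cst b))]" using sat by blast
      from wsat_singleton[OF tot this] obtain \<beta> where "wsat_lit B \<beta> (Neg (Eq (cst a) (cst b)))" .
      with ab(3) show False by (simp add: cst)
    qed
  next
    fix f as a assume f: "f \<in> funs ?\<Pi>" "func A f as = Some a"
    then have "[Pos (Eq (Fun (Inl f) (map cst as)) (cst a))] \<in> diagram ?\<Pi> A"
      by (auto simp: diagram_def)
    then have "wsat B [Pos (Eq (Fun (Inl f) (map cst as)) (cst a))]" using sat by blast
    from wsat_singleton[OF tot this] obtain \<beta> where \<beta>: "assignment B \<beta>"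
      "wsat_lit B \<beta> (Pos (Eq (Fun (Inl f) (map cst as)) (cst a)))" .
    \<comment> \<open>Weak satisfaction of the equation would be vacuous if its left side were
      undefined; totality of \<open>B\<close> rules this out.\<close>
    have "wf_trm (with_constants ?\<Pi>) (Fun (Inl f) (map cst as))"
      using f(1) partial_structure_func[OF A f(2)] by (auto simp: with_constants_def)
    from eval_total[OF tot \<beta>(1) this]
    have "func B (Inl f) (map i as) \<noteq> None" by (auto simp: cst comp_def)
    with \<beta>(2) show "func ?B f (map i as) = Some (i a)"
      by (auto simp: cst comp_def forget_constants_def)
  next
    fix p as assume p: "p \<in> preds ?\<Pi>" "as \<in> tuples (carrier A) (parity ?\<Pi> p)"
    show "as \<in> rel A p \<longleftrightarrow> map i as \<in> rel ?B p"
    proof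
      assume "as \<in> rel A p"
      then have "[Pos (Pr p (map cst as))] \<in> diagram ?\<Pi> A" using p by (auto simp: diagram_def)
      then have "wsat B [Pos (Pr p (map cst as))]" using sat by blast
      from wsat_singleton[OF tot this] obtain \<beta> where "wsat_lit B \<beta> (Pos (Pr p (map cst as)))" .
      then show "map i as \<in> rel ?B p"
        by (simp add: cst comp_def forget_constants_def)
    next
      assume r: "map i as \<in> rel ?B p"
      show "as \<in> rel A p"
      proof (rule ccontr)
        assume "as \<notin> rel A p"
        then have "[Neg (Pr p (map cst as))] \<in> diagram ?\<Pi> A" using p by (auto simp: diagram_def)
        then have "wsat B [Neg (Pr p (map cst as))]" using sat by blast
        from wsat_singleton[OF tot this] obtain \<beta> where "wsat_lit B \<beta> (Neg (Pr p (map cst as)))" .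
        with r show False by (simp add: cst comp_def forget_constants_def)
      qed
    qed
  qed
  ultimately show ?thesis by (auto simp: embeds_in_total_model_def)
qed

section \<open>Locality and embeddability\<close>

text \<open>By flatness the arguments of a \<Sigma>1-symbol are variables, so a ground
  \<Sigma>1-term of the axioms would be a constant, and such constants are excluded.\<close>

lemma flat_ground_trms:
  assumes "flat_clause \<Sigma>1 C" "\<forall>c\<in>\<Sigma>1. Fun c [] \<notin> clause_trms C"
    and "Fun f ts \<in> clause_trms C" "ground (Fun f ts)"
  shows "f \<notin> \<Sigma>1"
proof
  assume f: "f \<in> \<Sigma>1"
  then obtain t where t: "t \<in> set ts" using assms(2,3) by (cases ts) auto
  then obtain x where "t = Var x" using assms(1,3) f unfolding flat_clause_def by blast
  with t assms(4) show False by auto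
qed

text \<open>Stated for every subset \<open>G\<close> of the diagram, because the compactness
  argument applies it to finite subsets. A smaller \<open>G\<close> shrinks \<open>st K G\<close>,
  but all its terms remain defined in \<open>A\<close>.\<close>

lemma weak_partial_model_diagram:
  fixes A :: "('f, 'p, 'u) struct"
  assumes T0: "is_theory \<Pi>0 T0"
    and wf: "\<forall>C\<in>K. wf_clause (extend_sig \<Pi>0 \<Sigma>1) C"
    and flat: "\<forall>C\<in>K. flat_clause \<Sigma>1 C"
    and no_const: "\<forall>C\<in>K. \<forall>c\<in>\<Sigma>1. Fun c [] \<notin> clause_trms C"
    and A: "weak_partial_model \<Pi>0 \<Sigma>1 T0 K A"
    and G: "G \<subseteq> diagram (extend_sig \<Pi>0 \<Sigma>1) A"
  shows "weak_partial_model_c \<Pi>0 \<Sigma>1 T0 (instances \<Pi>0 \<Sigma>1 K G \<union> G) (name_constants A)"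
    and "\<forall>t\<in>st K G. defined_in (name_constants A) t"
proof -
  let ?\<Pi> = "extend_sig \<Pi>0 \<Sigma>1"
  let ?\<Pi>c = "with_constants ?\<Pi> :: ('f + 'u, 'p) signature"
  let ?N = "name_constants A"
  have ps: "partial_structure ?\<Pi> A" and red: "reduct \<Pi>0 A \<in> T0" and sat: "\<forall>C\<in>K. wsat A C"
    using A by (auto simp: weak_partial_model_def)
  have psN: "partial_structure ?\<Pi>c ?N"
    by (rule partial_structure_name_constants[OF ps])
  \<comment> \<open>Partiality is confined to \<Sigma>1: base symbols are total because the reduct
    is a model of \<open>T0\<close>, and constants because each has a value.\<close>
  have total: "dom (func ?N g) = tuples (carrier ?N) (farity ?\<Pi>c g)"
    if "g \<in> funs ?\<Pi>c" "g \<notin> Inl ` \<Sigma>1" for g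
  proof (cases g)
    case (Inl f)
    then have f: "f \<in> funs \<Pi>0" using that by (auto simp: with_constants_def extend_sig_def)
    have "total_structure \<Pi>0 (reduct \<Pi>0 A)" using T0 red by (auto simp: is_theory_def)
    then have "dom (func A f) = tuples (carrier A) (farity \<Pi>0 f)"
      using f by (auto simp: total_structure_def reduct_def)
    then show ?thesis
      using Inl by (simp add: name_constants_def with_constants_def extend_sig_def)
  next
    case (Inr c)
    then show ?thesis by (auto simp: name_constants_def with_constants_def tuples_def)
  qed
  show st: "\<forall>t\<in>st K G. defined_in ?N t"
  proof
    fix t assume "t \<in> st K G"
    then have gr: "ground t" and "(\<exists>C\<in>K. t \<in> clause_trms (lift_clause C)) \<or>
        (\<exists>C\<in>G. t \<in> clause_trms C)"
      by (auto simp: st_def)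
    then consider C where "C \<in> K" "t \<in> clause_trms (lift_clause C)"
      | C where "C \<in> G" "t \<in> clause_trms C" by blast
    then show "defined_in ?N t"
    proof cases
      case (1 C)
      show ?thesis
        unfolding defined_in_def
      proof (intro allI impI)
        fix \<beta> assume \<beta>: "assignment ?N \<beta>"
        \<comment> \<open>A ground term of a lifted axiom contains only symbols \<open>Inl f\<close>
          with \<open>f\<close> outside \<Sigma>1, all of them total.\<close>
        show "eval ?N \<beta> t \<noteq> None"
        proof (rule eval_defined[OF psN \<beta>])
          show "wf_trm ?\<Pi>c t"
            using wf_clause_trms[OF wf_clause_lift 1(2)] wf 1(1) by blast
        next
          fix g ts assume g: "Fun g ts \<in> subtrms t" "g \<in> funs ?\<Pi>c"
          then have "Fun g ts \<in> map_trm Inl ` clause_trms C"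
            using clause_trms_subtrms[OF 1(2)] by (simp add: clause_trms_lift)
          then obtain s where s: "s \<in> clause_trms C" "Fun g ts = map_trm Inl s" by blast
          then obtain f us where f: "s = Fun f us" "g = Inl f" by (cases s) auto
          have "ground s"
            using ground_subtrms[OF gr g(1)] unfolding s(2) ground_map_trm .
          then have "f \<notin> \<Sigma>1"
            using flat_ground_trms[of \<Sigma>1 C f us] flat no_const 1(1) s(1) f(1) by blast
          then show "eval ?N \<beta> (Fun g ts) \<noteq> None \<or>
              dom (func ?N g) = tuples (carrier ?N) (farity ?\<Pi>c g)"
            using total[OF g(2)] f(2) by blast
        qed
      qed
    next
      case (2 C)
      then show ?thesis using defined_diagram[OF ps] G by blast
    qed
  qed
  have "wsat ?N D" if D: "D \<in> instances \<Pi>0 \<Sigma>1 K G" for D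
    unfolding wsat_def
  proof (intro allI impI)
    fix \<beta> assume \<beta>: "assignment ?N \<beta>"
    obtain C \<sigma> where C: "C \<in> K" and D: "D = map (subst_lit \<sigma>) (lift_clause C)"
      and wf\<sigma>: "\<And>x. wf_trm ?\<Pi>c (\<sigma> x)"
      and inst: "\<And>t. t \<in> clause_trms D \<Longrightarrow> starts_with (Inl ` \<Sigma>1) t \<Longrightarrow> t \<in> st K G"
      using D by (auto simp: instances_def)
    \<comment> \<open>Subterms of \<open>\<sigma> x\<close> starting with a \<Sigma>1-symbol occur
      in the instance, so they belong to \<open>st K G\<close> and are defined; all other symbols
      are total.\<close>
    have def: "eval ?N \<beta> (\<sigma> x) \<noteq> None"
      if x: "Var x \<in> clause_trms (lift_clause C :: ('f + 'u, 'p) clause)" for x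
    proof (rule eval_defined[OF psN \<beta> wf\<sigma>])
      fix g ts assume g: "Fun g ts \<in> subtrms (\<sigma> x)" "g \<in> funs ?\<Pi>c"
      have "Fun g ts \<in> clause_trms D"
        using clause_trms_subst[OF x, of \<sigma>] g(1) D by auto
      then have "eval ?N \<beta> (Fun g ts) \<noteq> None" if "g \<in> Inl ` \<Sigma>1"
        using inst[of "Fun g ts"] that st \<beta> unfolding starts_with_def defined_in_def by blast
      then show "eval ?N \<beta> (Fun g ts) \<noteq> None \<or>
          dom (func ?N g) = tuples (carrier ?N) (farity ?\<Pi>c g)"
        using total[OF g(2)] by blast
    qed
    \<comment> \<open>The assignment that evaluates the substitution. The fallback
      \<open>\<beta> x\<close> only concerns variables that do not occur in
      \<open>C\<close>.\<close>
    define \<beta>' where "\<beta>' x = (case eval ?N \<beta> (\<sigma> x) of None \<Rightarrow> \<beta> x | Some a \<Rightarrow> a)" for x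
    have "assignment ?N \<beta>'"
      using \<beta> eval_in_carrier[OF psN \<beta>] by (auto simp: assignment_def \<beta>'_def split: option.split)
    \<comment> \<open>Forgetting the constants gives back \<open>A\<close>, which weakly satisfies
      \<open>C\<close> under every assignment, in particular under \<open>\<beta>'\<close>.\<close>
    moreover have "wsat ?N (lift_clause C)"
      using sat C by (simp add: wsat_lift forget_name_constants)
    ultimately obtain L where L: "L \<in> set (lift_clause C)" "wsat_lit ?N \<beta>' L"
      by (auto simp: wsat_def)
    have "wsat_lit ?N \<beta> (subst_lit \<sigma> L) \<longleftrightarrow> wsat_lit ?N \<beta>' L"
    proof (rule wsat_lit_subst)
      fix x assume "Var x \<in> atom_trms (atom_of L)"
      then have "Var x \<in> clause_trms (lift_clause C :: ('f + 'u, 'p) clause)"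
        using L(1) by (auto simp: clause_trms_def)
      from def[OF this] show "eval ?N \<beta> (\<sigma> x) = Some (\<beta>' x)" by (auto simp: \<beta>'_def)
    qed
    then show "\<exists>L\<in>set D. wsat_lit ?N \<beta> L" using L D by auto
  qed
  moreover have "wsat ?N D" if "D \<in> G" for D
    using wsat_diagram[OF ps] G that by blast
  ultimately show "weak_partial_model_c \<Pi>0 \<Sigma>1 T0 (instances \<Pi>0 \<Sigma>1 K G \<union> G) ?N"
    unfolding weak_partial_model_c_def forget_name_constants
    using psN red by (auto simp: name_constants_def)
qed

section \<open>The four implications\<close>

theorem theorem1:
  fixes \<Pi>0 :: "('f, 'p) signature" and \<Sigma>1 :: "'f set"
    and T0 :: "('f, 'p, 'u) struct set" and K :: "('f, 'p) clause set"
  assumes "is_theory \<Pi>0 T0"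
    and "\<Sigma>1 \<inter> funs \<Pi>0 = {}"
    and "\<forall>C\<in>K. wf_clause (extend_sig \<Pi>0 \<Sigma>1) C"
    and "\<forall>C\<in>K. flat_clause \<Sigma>1 C"
    and no_Sigma1_constants_in_K: "\<forall>C\<in>K. \<forall>c\<in>\<Sigma>1. Fun c [] \<notin> clause_trms C"
  shows "(Loc \<Pi>0 \<Sigma>1 T0 K \<longrightarrow> Emb_w \<Pi>0 \<Sigma>1 T0 K) \<and>
    (finite (funs \<Pi>0) \<and> finite \<Sigma>1 \<and> finite (preds \<Pi>0) \<longrightarrow>
      Loc_f \<Pi>0 \<Sigma>1 T0 K \<longrightarrow> Emb_w_f \<Pi>0 \<Sigma>1 T0 K) \<and>
    (finite \<Sigma>1 \<longrightarrow> Loc_fd \<Pi>0 \<Sigma>1 T0 K \<longrightarrow> Emb_w_fd \<Pi>0 \<Sigma>1 T0 K) \<and>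
    (compact_theory \<Pi>0 \<Sigma>1 T0 \<and> Loc_f \<Pi>0 \<Sigma>1 T0 K \<longrightarrow> Emb_w \<Pi>0 \<Sigma>1 T0 K)"
proof -
  let ?\<Pi> = "extend_sig \<Pi>0 \<Sigma>1"
  note weak_model = weak_partial_model_diagram[OF assms(1,3-5)]
  have ps: "partial_structure ?\<Pi> A" if "weak_partial_model \<Pi>0 \<Sigma>1 T0 K A" for A
    using that by (simp add: weak_partial_model_def)
  have ground: "ground_clauses \<Pi>0 \<Sigma>1 G"
    if "weak_partial_model \<Pi>0 \<Sigma>1 T0 K A" "G \<subseteq> diagram ?\<Pi> A"
    for A and G :: "('f + 'u, 'p) clause set"
    using wf_diagram[OF ps[OF that(1)]] that(2) by (auto simp: ground_clauses_def)
  \<comment> \<open>The named structure is a weak partial model of the instances and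
    \<open>G\<close> in which all terms of \<open>st K G\<close> are defined; by locality a total
    model must then exist as well.\<close>
  have ex_total: "\<exists>B. total_model_c \<Pi>0 \<Sigma>1 T0 (lift_clause ` K \<union> G) B"
    if "weak_partial_model \<Pi>0 \<Sigma>1 T0 K A" "G \<subseteq> diagram ?\<Pi> A" "local_for \<Pi>0 \<Sigma>1 T0 K G" for A G
    using weak_model[OF that(1,2)] that(3) unfolding local_for_def by blast
  have embeds: "embeds_in_total_model \<Pi>0 \<Sigma>1 T0 K A"
    if A: "weak_partial_model \<Pi>0 \<Sigma>1 T0 K A" and loc: "local_for \<Pi>0 \<Sigma>1 T0 K (diagram ?\<Pi> A)"
    for A
  proof -
    obtain B where "total_model_c \<Pi>0 \<Sigma>1 T0 (lift_clause ` K \<union> diagram ?\<Pi> A) B"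
      using ex_total[OF A subset_refl loc] ..
    then show ?thesis by (rule embedding_of_diagram_model[OF ps[OF A]])
  qed
  have part1: "Emb_w \<Pi>0 \<Sigma>1 T0 K" if "Loc \<Pi>0 \<Sigma>1 T0 K"
    unfolding Emb_w_def
  proof (intro allI impI)
    fix A assume A: "weak_partial_model \<Pi>0 \<Sigma>1 T0 K A"
    show "embeds_in_total_model \<Pi>0 \<Sigma>1 T0 K A"
      using that ground[OF A subset_refl] by (intro embeds[OF A]) (simp add: Loc_def)
  qed
  have part2: "Emb_w_f \<Pi>0 \<Sigma>1 T0 K"
    if "finite (funs \<Pi>0)" "finite \<Sigma>1" "finite (preds \<Pi>0)" "Loc_f \<Pi>0 \<Sigma>1 T0 K"
    unfolding Emb_w_f_def
  proof (intro allI impI, elim conjE)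
    fix A :: "('f, 'p, 'u) struct"
    assume A: "weak_partial_model \<Pi>0 \<Sigma>1 T0 K A" "finite (carrier A)"
    have "finite (funs ?\<Pi>)" "finite (preds ?\<Pi>)" using that by (simp_all add: extend_sig_def)
    from finite_diagram[OF ps[OF A(1)] A(2) this] show "embeds_in_total_model \<Pi>0 \<Sigma>1 T0 K A"
      using that(4) ground[OF A(1) subset_refl] by (intro embeds[OF A(1)]) (simp add: Loc_f_def)
  qed
  have part3: "Emb_w_fd \<Pi>0 \<Sigma>1 T0 K" if "finite \<Sigma>1" "Loc_fd \<Pi>0 \<Sigma>1 T0 K"
    unfolding Emb_w_fd_def
  proof (intro allI impI, elim conjE)
    fix A :: "('f, 'p, 'u) struct"
    assume A: "weak_partial_model \<Pi>0 \<Sigma>1 T0 K A" "\<forall>f\<in>\<Sigma>1. finite (dom (func A f))"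
    have "local_for \<Pi>0 \<Sigma>1 T0 K (diagram ?\<Pi> A)"
      using that(2)[unfolded Loc_fd_def, THEN spec, THEN mp]
        conjI[OF ground[OF A(1) subset_refl] finite_diagram_trms[OF that(1) A(2), of ?\<Pi>]] .
    then show "embeds_in_total_model \<Pi>0 \<Sigma>1 T0 K A" by (rule embeds[OF A(1)])
  qed
  have part4: "Emb_w \<Pi>0 \<Sigma>1 T0 K" if comp: "compact_theory \<Pi>0 \<Sigma>1 T0" and loc: "Loc_f \<Pi>0 \<Sigma>1 T0 K"
    unfolding Emb_w_def
  proof (intro allI impI)
    fix A assume A: "weak_partial_model \<Pi>0 \<Sigma>1 T0 K A"
    let ?\<Pi>c = "with_constants ?\<Pi> :: ('f + 'u, 'p) signature"
    \<comment> \<open>Compactness of \<open>T0\<close> treats the \<Sigma>1-symbols and the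
      constants as free, so the axioms \<open>K\<close> have to be among the formulae along with the
      diagram.\<close>
    let ?N = "lift_clause ` K \<union> diagram ?\<Pi> A"
    have wfN: "wf_clause ?\<Pi>c C" if "C \<in> ?N" for C
      using that assms(3) wf_clause_lift wf_diagram(1)[OF ps[OF A]] by blast
    have fin_sat: "satisfiable_with \<Pi>0 \<Sigma>1 T0 F" if F: "F \<subseteq> clause_fm ` ?N" "finite F" for F
    proof -
      obtain N' where N': "N' \<subseteq> ?N" "finite N'" "F = clause_fm ` N'"
        using finite_subset_image[OF F(2,1)] by blast
      \<comment> \<open>Only the diagram clauses of \<open>N'\<close> serve as ground clauses, so
        that this set is finite; the axioms in \<open>N'\<close> hold because the total model
        obtained satisfies all of \<open>K\<close>.\<close>
      let ?G = "N' \<inter> diagram ?\<Pi> A"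
      have "local_for \<Pi>0 \<Sigma>1 T0 K ?G"
        using loc ground[OF A, of ?G] N'(2) by (auto simp: Loc_f_def)
      then obtain B where B: "total_model_c \<Pi>0 \<Sigma>1 T0 (lift_clause ` K \<union> ?G) B"
        using ex_total[OF A, of ?G] by blast
      then have "total_structure ?\<Pi>c B" by (simp add: total_model_c_def)
      then have valid: "fm_valid B (clause_fm C)" if "C \<in> N'" for C
      proof -
        have "C \<in> lift_clause ` K \<union> ?G" "wf_clause ?\<Pi>c C" using that N'(1) wfN by auto
        then show ?thesis
          using B fm_valid_clause_fm[OF \<open>total_structure ?\<Pi>c B\<close>] by (simp add: total_model_c_def)
      qed
      have "fm_valid B \<phi>" if "\<phi> \<in> F" for \<phi>
        using that valid N'(3) by auto
      then show ?thesis using B by (auto simp: satisfiable_with_def total_model_c_def)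
    qed
    have "\<forall>\<phi>\<in>clause_fm ` ?N. wf_fm ?\<Pi>c \<phi>" using wfN by (auto simp: wf_clause_fm)
    then have "satisfiable_with \<Pi>0 \<Sigma>1 T0 (clause_fm ` ?N)"
      using comp fin_sat unfolding compact_theory_def by blast
    then obtain B where B: "total_model_c \<Pi>0 \<Sigma>1 T0 {} B" "\<And>C. C \<in> ?N \<Longrightarrow> fm_valid B (clause_fm C)"
      by (auto simp: satisfiable_with_def)
    then have "wsat B C" if "C \<in> ?N" for C
      using that wfN[OF that] fm_valid_clause_fm[of ?\<Pi>c B C] by (auto simp: total_model_c_def)
    then have "total_model_c \<Pi>0 \<Sigma>1 T0 ?N B" using B(1) by (simp add: total_model_c_def)
    then show "embeds_in_total_model \<Pi>0 \<Sigma>1 T0 K A"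
      by (rule embedding_of_diagram_model[OF ps[OF A]])
  qed
  show ?thesis using part1 part2 part3 part4 by blast
qed

end
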